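(* Let $n\ge 2$. If $\Gamma(\mathbb{Z}_n)$ has at least one vertex and is regular, then $\Gamma(\mathbb{Z}_n)$ is complete. (Equivalently, there is no $\Gamma(\mathbb{Z}_n)$ that is non-empty, non-complete and regular.)
   Context: For a commutative ring $R$ with identity, the zero-divisor graph $\Gamma(R)$ is the simple undirected graph whose vertices are the nonzero zero-divisors of $R$, two distinct vertices $u,v$ being adjacent iff $uv=0$. A graph is regular if all vertices have the same degree. *)

theory Defs
  imports "HOL-Number_Theory.Residues" "Graph_Theory.Kuratowski"
begin

definition nonzero_zero_divisors :: "('a, 'm) ring_scheme \<Rightarrow> 'a set" where
  "nonzero_zero_divisors R =
     {u \<in> carrier R - {\<zero>\<^bsub>R\<^esub>}. \<exists>v \<in> carrier R - {\<zero>\<^bsub>R\<^esub>}. u \<otimes>\<^bsub>R\<^esub> v = \<zero>\<^bsub>R\<^esub>}"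

text \<open>As everywhere in the Graph_Theory entry, a simple undirected graph is a loop-free symmetric
  digraph: an undirected edge between \<open>u\<close> and \<open>v\<close> is the pair of arcs \<open>(u, v)\<close> and \<open>(v, u)\<close>.\<close>

definition zero_divisor_graph :: "('a, 'm) ring_scheme \<Rightarrow> 'a pair_pre_digraph" where
  "zero_divisor_graph R =
     \<lparr> pverts = nonzero_zero_divisors R,
       parcs = {(u, v). u \<in> nonzero_zero_divisors R \<and> v \<in> nonzero_zero_divisors R
                        \<and> u \<noteq> v \<and> u \<otimes>\<^bsub>R\<^esub> v = \<zero>\<^bsub>R\<^esub>} \<rparr>"

lemma (in cring) pair_graph_zero_divisor_graph:
  assumes "finite (carrier R)"
  shows "pair_graph (zero_divisor_graph R)"
proof -
  let ?V = "nonzero_zero_divisors R" and ?E = "parcs (zero_divisor_graph R)"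
  have V: "?V \<subseteq> carrier R" by (auto simp: nonzero_zero_divisors_def)
  with assms have fin: "finite ?V" by (rule finite_subset[rotated])
  have E: "?E \<subseteq> ?V \<times> ?V" by (auto simp: zero_divisor_graph_def)
  with fin have finE: "finite ?E" by (meson finite_SigmaI finite_subset)
  have "sym ?E"
    using V by (auto simp: sym_def zero_divisor_graph_def m_comm subset_iff)
  then show ?thesis
    using fin finE by unfold_locales (auto simp: zero_divisor_graph_def symmetric_def)
qed

text \<open>In a symmetric digraph the undirected degree of a vertex is its out-degree (which equals its
  in-degree). Since degrees are cardinalities, this definition is meant for finite graphs.\<close>

definition regular_graph :: "('a, 'b) pre_digraph \<Rightarrow> bool" where
  "regular_graph G \<longleftrightarrow> (\<exists>k. \<forall>v \<in> verts G. out_degree G v = k)"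

lemma out_degree_zero_divisor_graph:
  assumes "u \<in> nonzero_zero_divisors R"
  shows "out_degree (with_proj (zero_divisor_graph R)) u =
    card {v \<in> nonzero_zero_divisors R. v \<noteq> u \<and> u \<otimes>\<^bsub>R\<^esub> v = \<zero>\<^bsub>R\<^esub>}"
proof -
  have "out_arcs (with_proj (zero_divisor_graph R)) u =
      Pair u ` {v \<in> nonzero_zero_divisors R. v \<noteq> u \<and> u \<otimes>\<^bsub>R\<^esub> v = \<zero>\<^bsub>R\<^esub>}"
    using assms by (auto simp: out_arcs_def zero_divisor_graph_def)
  then show ?thesis
    by (simp add: out_degree_def card_image inj_on_def)
qed

definition complete_graph :: "('a, 'b) pre_digraph \<Rightarrow> bool" where
  "complete_graph G \<longleftrightarrow> complete_digraph (card (verts G)) G"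

end

theory Submission
  imports Defs
begin

text \<open>If \<open>n = a b\<close> with \<open>a, b > 1\<close>, the annihilator of \<open>a\<close> consists of the multiples of \<open>b\<close>, so the
  vertex \<open>a\<close> has degree \<open>a - 1\<close>, or \<open>a - 2\<close> if \<open>b\<close> divides \<open>a\<close> (no loop at \<open>a\<close>). Comparing with the
  degree of the vertex \<open>b\<close>, regularity forces \<open>a = b\<close>. Hence every zero-divisor \<open>u\<close> satisfies
  \<open>gcd u n ^ 2 = n\<close>, and the product of any two zero-divisors vanishes modulo \<open>n\<close>.\<close>

lemma nonzero_zero_divisors_residue_ring:
  "nonzero_zero_divisors (residue_ring n) =
     {u \<in> {1..<n}. \<exists>v \<in> {1..<n}. n dvd u * v}"
  by (auto simp: nonzero_zero_divisors_def residue_ring_def mod_eq_0_iff_dvd)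

lemma residue_ring_mult_eq_zero_iff:
  "u \<otimes>\<^bsub>residue_ring n\<^esub> v = \<zero>\<^bsub>residue_ring n\<^esub> \<longleftrightarrow> n dvd u * v"
  by (simp add: residue_ring_def mod_eq_0_iff_dvd)

lemma proper_divisor_nonzero_zero_divisor:
  fixes a b :: int
  assumes "a > 1" "b > 1"
  shows "a \<in> nonzero_zero_divisors (residue_ring (a * b))"
  unfolding nonzero_zero_divisors_residue_ring
  using assms by (auto intro!: bexI[of _ b] simp: less_1_mult)

lemma out_degree_proper_divisor:
  fixes a b :: int
  assumes "a > 1" "b > 1"
  shows "int (out_degree (with_proj (zero_divisor_graph (residue_ring (a * b)))) a) =
           a - (if b dvd a then 2 else 1)"
proof -
  let ?S = "(*) b ` {1..<a}"
  have "{v \<in> nonzero_zero_divisors (residue_ring (a * b)). v \<noteq> a \<and> a * b dvd a * v} = ?S - {a}"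
    (is "?N = _")
  proof (intro equalityI subsetI)
    fix v assume v: "v \<in> ?N"
    then obtain k where k: "v = b * k"
      using assms by auto
    moreover have "0 < b * k" "b * k < b * a"
      using v k by (auto simp: nonzero_zero_divisors_residue_ring mult.commute)
    ultimately show "v \<in> ?S - {a}"
      using v assms by (auto simp: zero_less_mult_iff)
  next
    fix v assume "v \<in> ?S - {a}"
    then obtain k where k: "v = b * k" "1 \<le> k" "k < a" "v \<noteq> a" by fastforce
    have "1 \<le> b * k"
      using k assms mult_pos_pos[of b k] by linarith
    moreover have "b * k < a * b"
      using k assms by (simp add: mult.commute)
    \<comment> \<open>This bound makes \<open>a\<close> an admissible witness that \<open>v\<close>
      is a vertex: \<open>v * a\<close> is a multiple of \<open>a * b\<close>.\<close>
    moreover have "a < a * b" using assms by simp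
    ultimately show "v \<in> ?N"
      using k assms by (auto simp: nonzero_zero_divisors_residue_ring intro!: bexI[of _ a])
  qed
  \<comment> \<open>Decides whether excluding the loop removes an element of \<open>?S\<close>. The
    cofactor of \<open>b\<close> in \<open>a\<close> lies below \<open>a\<close> because
    \<open>b > 1\<close>.\<close>
  moreover have "a \<in> ?S \<longleftrightarrow> b dvd a"
  proof
    assume "b dvd a"
    then obtain k where k: "a = b * k" by auto
    with assms have "k > 0" using zero_less_mult_pos[of b k] by simp
    with k assms have "k \<in> {1..<a}" by auto
    with k show "a \<in> ?S" by blast
  qed auto
  moreover have "card ?S = nat (a - 1)"
    using assms by (subst card_image) (auto simp: inj_on_def)
  ultimately show ?thesis
    using assms proper_divisor_nonzero_zero_divisor[OF assms]
    by (simp add: out_degree_zero_divisor_graph residue_ring_mult_eq_zero_iff card_Diff_singleton_if)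
qed

lemma regular_zero_divisor_graph_factors_eq:
  fixes a b :: int
  assumes "a > 1" "b > 1"
    and "regular_graph (with_proj (zero_divisor_graph (residue_ring (a * b))))"
  shows "a = b"
proof (rule ccontr)
  assume "a \<noteq> b"
  let ?G = "with_proj (zero_divisor_graph (residue_ring (a * b)))"
  have "a \<in> verts ?G" "b \<in> verts ?G"
    using proper_divisor_nonzero_zero_divisor[of a b] proper_divisor_nonzero_zero_divisor[of b a] assms
    by (simp_all add: zero_divisor_graph_def mult.commute)
  with assms have "out_degree ?G a = out_degree ?G b"
    by (auto simp: regular_graph_def)
  then have eq: "a - (if b dvd a then 2 else 1) = b - (if a dvd b then 2 else 1)"
    using out_degree_proper_divisor[of a b] out_degree_proper_divisor[of b a] assms
    by (simp add: mult.commute)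
  \<comment> \<open>The loop corrections differ by at most one, so distinct factors would be
    consecutive, with the smaller dividing the larger and hence dividing 1.\<close>
  with \<open>a \<noteq> b\<close> consider "b dvd a" "a = b + 1" | "a dvd b" "b = a + 1"
    by (auto split: if_splits)
  then show False
    using assms by cases auto
qed

text \<open>The gcd \<open>d\<close> is a nontrivial divisor of \<open>n\<close>: if it were 1,
  \<open>u\<close> could be cancelled from \<open>n dvd u * v\<close>, and it is at most
  \<open>u < n\<close>. So \<open>n\<close> splits into \<open>d\<close> and a cofactor, both above
  1, which regularity makes equal.\<close>

lemma regular_zero_divisor_graph_gcd:
  fixes n u :: int
  assumes "regular_graph (with_proj (zero_divisor_graph (residue_ring n)))"
    and "u \<in> nonzero_zero_divisors (residue_ring n)"
  shows "gcd u n * gcd u n = n"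
proof -
  obtain v where "u \<in> {1..<n}" "v \<in> {1..<n}" "n dvd u * v"
    using assms(2) by (auto simp: nonzero_zero_divisors_residue_ring)
  then have u: "0 < u" "u < n" and v: "0 < v" "v < n" "n dvd u * v"
    by auto
  define d where "d = gcd u n"
  obtain e where e: "n = d * e"
    unfolding d_def by (meson dvdE gcd_dvd2)
  have "d > 0" using u by (simp add: d_def)
  have "d \<le> u" using u by (simp add: d_def zdvd_imp_le)
  have "d \<noteq> 1"
  proof
    assume "d = 1"
    then have "coprime n u" by (simp add: d_def coprime_iff_gcd_eq_1 gcd.commute)
    with v(3) have "n dvd v" by (simp only: coprime_dvd_mult_right_iff)
    with v show False using zdvd_imp_le[of n v] by linarith
  qed
  have "0 < d * e" using u e by simp
  then have "e > 0" using \<open>d > 0\<close> by (simp add: zero_less_mult_iff)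
  moreover have "e \<noteq> 1" using \<open>d \<le> u\<close> \<open>u < n\<close> e by force
  ultimately have "d = e"
    using \<open>d > 0\<close> \<open>d \<noteq> 1\<close> assms(1)[unfolded e]
    by (intro regular_zero_divisor_graph_factors_eq) auto
  with e show ?thesis by (simp add: d_def)
qed

theorem theorem2p15:
  fixes n :: nat
  assumes "n \<ge> 2"
    and "verts (with_proj (zero_divisor_graph (residue_ring (int n)))) \<noteq> {}"
    and "regular_graph (with_proj (zero_divisor_graph (residue_ring (int n))))"
  shows "complete_graph (with_proj (zero_divisor_graph (residue_ring (int n))))"
proof -
  let ?V = "nonzero_zero_divisors (residue_ring (int n))"
  have "int n dvd u * v" if "u \<in> ?V" "v \<in> ?V" for u v
  proof -
    have sq: "gcd u n * gcd u n = int n" "gcd v n * gcd v n = int n"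
      using regular_zero_divisor_graph_gcd[OF assms(3)] that by auto
    then have "(gcd u n)\<^sup>2 = (gcd v n)\<^sup>2"
      by (simp add: power2_eq_square)
    \<comment> \<open>Gcds are nonnegative, so equal squares give equal gcds. This common square
      root of \<open>n\<close> divides both \<open>u\<close> and \<open>v\<close>, hence
      \<open>n\<close> divides \<open>u * v\<close>.\<close>
    then have "gcd u n = gcd v n"
      by (simp add: power2_eq_iff_nonneg)
    with sq show ?thesis
      by (metis gcd_dvd1 mult_dvd_mono)
  qed
  moreover have "finite ?V"
    by (rule finite_subset[of _ "{1..<int n}"]) (auto simp: nonzero_zero_divisors_residue_ring)
  ultimately show ?thesis
    by (auto simp: complete_graph_def complete_digraph_pair_def zero_divisor_graph_def
        residue_ring_mult_eq_zero_iff)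
qed

end
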